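(* Let $(W,S)$ be a Coxeter system with $|S|<\infty$ and let $G$ be a group of automorphisms of $W$ each of which preserves $S$. Let $W^G$ be the subgroup of $G$-fixed elements and $(\widetilde W,\widetilde S)$, $\phi$ as in the context. Then the subposet of the Bruhat order $\mathrm{Br}(W)$ induced by $W^G$ is isomorphic to the Bruhat order $\mathrm{Br}(\widetilde W)$.
   Context: Bruhat order on a Coxeter group: $v\le w$ iff some reduced expression of $w$ contains a subexpression that is a reduced expression of $v$. For $J\subseteq S$ with $W_J=\langle J\rangle$ finite, $w_0(J)$ is the longest element of $W_J$. Let $\widetilde S=\{\widetilde s_J\mid J\subseteq S\text{ is a }G\text{-orbit and }W_J\text{ finite}\}$. By a known theorem (H\'ee, M\"uhlherr, Steinberg), with suitable Coxeter relations $\widetilde S$ generates a Coxeter system $(\widetilde W,\widetilde S)$ such that $\widetilde s_J\mapsto w_0(J)$ defines an injective group homomorphism $\phi:\widetilde W\to W$ with image $W^G$; in particular $W^G\cong\widetilde W$. *)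

theory Defs
  imports
    "HOL-Algebra.Bij"
    "HOL-Algebra.Generated_Groups"
    "HOL-Algebra.Group_Action"
    "HOL-Library.Extended_Nat"
    "HOL-Library.Sublist"
begin

section \<open>Coxeter systems\<close>

definition coxeter_matrix :: "'a set \<Rightarrow> ('a \<Rightarrow> 'a \<Rightarrow> enat) \<Rightarrow> bool" where
  "coxeter_matrix S m \<longleftrightarrow>
     (\<forall>s\<in>S. m s s = 1) \<and>
     (\<forall>s\<in>S. \<forall>t\<in>S. s \<noteq> t \<longrightarrow> m s t = m t s \<and> 2 \<le> m s t)"

text \<open>
  The congruence on words over \<open>S\<close> generated by the relations \<open>(st)^m(s,t) = 1\<close> for finite
  \<open>m(s,t)\<close>. Since \<open>m(s,s) = 1\<close> makes every letter its own inverse, the quotient of the free monoid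
  by this congruence is the group with generators \<open>S\<close> and these relations; words with formal
  inverses are not needed.
\<close>

inductive coxeter_cong :: "'a set \<Rightarrow> ('a \<Rightarrow> 'a \<Rightarrow> enat) \<Rightarrow> 'a list \<Rightarrow> 'a list \<Rightarrow> bool"
  for S :: "'a set" and m :: "'a \<Rightarrow> 'a \<Rightarrow> enat" where
  rel: "\<lbrakk>s \<in> S; t \<in> S; m s t = enat k\<rbrakk> \<Longrightarrow> coxeter_cong S m (concat (replicate k [s, t])) []"
| refl: "xs \<in> lists S \<Longrightarrow> coxeter_cong S m xs xs"
| sym: "coxeter_cong S m xs ys \<Longrightarrow> coxeter_cong S m ys xs"
| trans: "\<lbrakk>coxeter_cong S m xs ys; coxeter_cong S m ys zs\<rbrakk> \<Longrightarrow> coxeter_cong S m xs zs"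
| append: "\<lbrakk>coxeter_cong S m xs xs'; coxeter_cong S m ys ys'\<rbrakk>
    \<Longrightarrow> coxeter_cong S m (xs @ ys) (xs' @ ys')"

definition eval_word :: "('a, 'b) monoid_scheme \<Rightarrow> 'a list \<Rightarrow> 'a" where
  "eval_word W xs = foldr (mult W) xs (one W)"

text \<open>
  The last conjunct says that the canonical map from the presented group to \<open>W\<close> is well defined
  and injective, the one before it that this map is surjective.
\<close>

definition coxeter_system :: "('a, 'b) monoid_scheme \<Rightarrow> 'a set \<Rightarrow> bool" where
  "coxeter_system W S \<longleftrightarrow>
     group W \<and> S \<subseteq> carrier W \<and>
     (\<exists>m. coxeter_matrix S m \<and> generate W S = carrier W \<and>
        (\<forall>xs\<in>lists S. \<forall>ys\<in>lists S. eval_word W xs = eval_word W ys \<longleftrightarrow> coxeter_cong S m xs ys))"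

section \<open>Length and Bruhat order\<close>

definition expression :: "('a, 'b) monoid_scheme \<Rightarrow> 'a set \<Rightarrow> 'a list \<Rightarrow> 'a \<Rightarrow> bool" where
  "expression W S xs w \<longleftrightarrow> xs \<in> lists S \<and> eval_word W xs = w"

definition cox_length :: "('a, 'b) monoid_scheme \<Rightarrow> 'a set \<Rightarrow> 'a \<Rightarrow> nat" where
  "cox_length W S w = (LEAST n. \<exists>xs. expression W S xs w \<and> length xs = n)"

definition reduced_expression :: "('a, 'b) monoid_scheme \<Rightarrow> 'a set \<Rightarrow> 'a list \<Rightarrow> 'a \<Rightarrow> bool" where
  "reduced_expression W S xs w \<longleftrightarrow> expression W S xs w \<and> length xs = cox_length W S w"

definition bruhat_le :: "('a, 'b) monoid_scheme \<Rightarrow> 'a set \<Rightarrow> 'a \<Rightarrow> 'a \<Rightarrow> bool" where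
  "bruhat_le W S v w \<longleftrightarrow>
     (\<exists>xs ys. reduced_expression W S xs w \<and> subseq ys xs \<and> reduced_expression W S ys v)"

text \<open>Only meaningful when \<open>generate W J\<close> is finite; the maximum is then attained exactly once.\<close>

definition longest_element :: "('a, 'b) monoid_scheme \<Rightarrow> 'a set \<Rightarrow> 'a set \<Rightarrow> 'a" where
  "longest_element W S J = (ARG_MAX (cox_length W S) w. w \<in> generate W J)"

section \<open>Automorphisms preserving the generators\<close>

definition generator_automorphism_group ::
    "('a, 'b) monoid_scheme \<Rightarrow> 'a set \<Rightarrow> ('a \<Rightarrow> 'a) set \<Rightarrow> bool" where
  "generator_automorphism_group W S G \<longleftrightarrow>
     subgroup G (AutoGroup W) \<and> (\<forall>g\<in>G. g ` S = S)"

definition fixed_points :: "('a, 'b) monoid_scheme \<Rightarrow> ('a \<Rightarrow> 'a) set \<Rightarrow> 'a set" where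
  "fixed_points W G = {w \<in> carrier W. \<forall>g\<in>G. g w = w}"

definition finite_type_orbits ::
    "('a, 'b) monoid_scheme \<Rightarrow> 'a set \<Rightarrow> ('a \<Rightarrow> 'a) set \<Rightarrow> 'a set set" where
  "finite_type_orbits W S G =
     {J \<in> orbits ((AutoGroup W)\<lparr>carrier := G\<rparr>) S (\<lambda>g. g). finite (generate W J)}"

text \<open>
  The data attached to \<open>(W, S)\<close> and \<open>G\<close> by the theorem of Hee, Muehlherr and Steinberg:
  \<open>st J\<close> is the generator indexed by the orbit \<open>J\<close>. These properties determine
  \<open>(Wt, st, \<phi>)\<close> up to unique isomorphism.
\<close>

definition fixed_coxeter_system ::
    "('a, 'c) monoid_scheme \<Rightarrow> 'a set \<Rightarrow> ('a \<Rightarrow> 'a) set \<Rightarrow>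
     ('b, 'd) monoid_scheme \<Rightarrow> 'b set \<Rightarrow> ('a set \<Rightarrow> 'b) \<Rightarrow> ('b \<Rightarrow> 'a) \<Rightarrow> bool" where
  "fixed_coxeter_system W S G Wt St st \<phi> \<longleftrightarrow>
     coxeter_system Wt St \<and>
     St = st ` finite_type_orbits W S G \<and>
     \<phi> \<in> hom Wt W \<and> inj_on \<phi> (carrier Wt) \<and> \<phi> ` carrier Wt = fixed_points W G \<and>
     (\<forall>J\<in>finite_type_orbits W S G. \<phi> (st J) = longest_element W S J)"

section \<open>Isomorphism of posets\<close>

definition poset_isomorphic ::
    "'a set \<Rightarrow> ('a \<Rightarrow> 'a \<Rightarrow> bool) \<Rightarrow> 'b set \<Rightarrow> ('b \<Rightarrow> 'b \<Rightarrow> bool) \<Rightarrow> bool" where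
  "poset_isomorphic A leA B leB \<longleftrightarrow>
     (\<exists>f. bij_betw f A B \<and> (\<forall>x\<in>A. \<forall>y\<in>A. leA x y \<longleftrightarrow> leB (f x) (f y)))"

end

theory Submission
  imports Defs
begin

text \<open>
  For an orbit \<open>J\<close> with \<open>W\<^sub>J\<close> finite, \<open>1\<close> and \<open>w\<^sub>0(J)\<close> are the only fixed points in \<open>W\<^sub>J\<close>, and
  the left descents of a fixed point \<open>u\<close> contain either all of \<open>J\<close> or none of it. By the exchange
  property of \<open>W\<close> the first case occurs for \<open>u = \<phi>(v)\<close> exactly when the generator of \<open>J\<close> is a
  descent of \<open>v\<close>. Hence \<open>\<phi>\<close> turns reduced expressions into concatenations of reduced
  expressions that are again reduced, so it preserves the Bruhat order. Conversely, if
  \<open>w = zw'\<close> with \<open>z\<close> the generator of \<open>J\<close> and \<open>w'\<close> shorter, then passing to minimal coset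
  representatives of \<open>W\<^sub>J\<close> is monotone and reduces \<open>\<phi>(v) \<le> \<phi>(w)\<close> to
  \<open>\<phi>(v') \<le> \<phi>(w')\<close> with \<open>v'\<close> the shorter of \<open>v\<close> and \<open>zv\<close>.

  The exchange property comes from a sign: the parity of the multiplicity of a reflection in a
  word depends only on the value of the word.
\<close>

section \<open>Coxeter systems with a chosen matrix, and words in the generators\<close>

locale coxeter = group W for W :: "('a, 'c) monoid_scheme" (structure) +
  fixes S :: "'a set" and m :: "'a \<Rightarrow> 'a \<Rightarrow> enat"
  assumes gens_closed: "S \<subseteq> carrier W"
    and matrix: "coxeter_matrix S m"
    and generates: "generate W S = carrier W"
    and presentation: "\<And>xs ys. \<lbrakk>xs \<in> lists S; ys \<in> lists S\<rbrakk> \<Longrightarrow>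
      eval_word W xs = eval_word W ys \<longleftrightarrow> coxeter_cong S m xs ys"

lemma coxeter_system_imp_coxeter:
  assumes "coxeter_system W S"
  obtains m where "coxeter W S m"
  using assms unfolding coxeter_system_def coxeter_def coxeter_axioms_def by blast

context coxeter
begin

abbreviation ev :: "'a list \<Rightarrow> 'a" where "ev \<equiv> eval_word W"
abbreviation len :: "'a \<Rightarrow> nat" where "len \<equiv> cox_length W S"

lemma ev_Nil [simp]: "ev [] = \<one>"
  and ev_Cons [simp]: "ev (x # xs) = x \<otimes> ev xs"
  by (simp_all add: eval_word_def)

lemma gen_closed [simp, intro]: "s \<in> S \<Longrightarrow> s \<in> carrier W"
  using gens_closed by blast

lemma ev_closed [simp, intro]: "xs \<in> lists S \<Longrightarrow> ev xs \<in> carrier W"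
  by (induction xs) auto

lemma ev_append: "\<lbrakk>xs \<in> lists S; ys \<in> lists S\<rbrakk> \<Longrightarrow> ev (xs @ ys) = ev xs \<otimes> ev ys"
  by (induction xs) (auto simp: m_assoc)

lemma gen_square [simp]:
  assumes "s \<in> S" shows "s \<otimes> s = \<one>"
proof -
  have "m s s = enat 1"
    using matrix assms unfolding coxeter_matrix_def one_enat_def by blast
  from coxeter_cong.rel[of s S s m 1, OF assms assms this]
  have "ev [s, s] = ev []"
    using presentation[of "[s,s]" "[]"] assms by (simp del: ev_Cons ev_Nil)
  with assms show ?thesis by simp
qed

lemma gen_cancel [simp]: "\<lbrakk>s \<in> S; x \<in> carrier W\<rbrakk> \<Longrightarrow> s \<otimes> (s \<otimes> x) = x"
  by (simp flip: m_assoc)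

lemma inv_cancel [simp]:
  "\<lbrakk>x \<in> carrier W; y \<in> carrier W\<rbrakk> \<Longrightarrow> inv x \<otimes> (x \<otimes> y) = y"
  "\<lbrakk>x \<in> carrier W; y \<in> carrier W\<rbrakk> \<Longrightarrow> x \<otimes> (inv x \<otimes> y) = y"
  by (simp_all flip: m_assoc)

lemma gen_inv [simp]: "s \<in> S \<Longrightarrow> inv s = s"
  by (simp add: inv_equality)

text \<open>Generators are involutions, so words without formal inverses already exhaust the
  subgroup.\<close>

lemma generate_words:
  assumes "J \<subseteq> S"
  shows "generate W J = ev ` lists J"
proof
  show "generate W J \<subseteq> ev ` lists J"
  proof
    fix x assume "x \<in> generate W J"
    then show "x \<in> ev ` lists J"
    proof induction
      case one
      then show ?case by (force intro: image_eqI[of _ _ "[]"])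
    next
      case (incl h)
      then show ?case using assms by (force intro: image_eqI[of _ _ "[h]"])
    next
      case (inv h)
      then show ?case using assms by (force intro: image_eqI[of _ _ "[h]"])
    next
      case (eng h1 h2)
      then obtain xs ys where "xs \<in> lists J" "h1 = ev xs" "ys \<in> lists J" "h2 = ev ys" by auto
      then show ?case
        using ev_append[of xs ys] lists_mono[OF assms]
        by (intro image_eqI[of _ _ "xs @ ys"]) (simp_all add: subset_iff)
    qed
  qed
  have "ev xs \<in> generate W J" if "xs \<in> lists J" for xs
    using that by induction (auto intro: generate.intros)
  then show "ev ` lists J \<subseteq> generate W J" by auto
qed

lemma carrier_word:
  assumes "w \<in> carrier W"
  obtains xs where "xs \<in> lists S" "w = ev xs"
  using assms generate_words[of S] generates by auto

section \<open>Length\<close>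

lemma len_le: "xs \<in> lists S \<Longrightarrow> len (ev xs) \<le> length xs"
  unfolding cox_length_def expression_def by (rule Least_le) auto

lemma reduced_word:
  assumes "w \<in> carrier W"
  obtains xs where "xs \<in> lists S" "ev xs = w" "length xs = len w"
proof -
  obtain ys where "ys \<in> lists S" "w = ev ys" using carrier_word[OF assms] .
  then have "\<exists>n xs. expression W S xs w \<and> length xs = n"
    by (auto simp: expression_def)
  then have "\<exists>xs. expression W S xs w \<and> length xs = len w"
    unfolding cox_length_def by (rule LeastI_ex)
  then show ?thesis using that by (auto simp: expression_def)
qed

lemma reduced_expression_iff:
  "reduced_expression W S xs w \<longleftrightarrow> xs \<in> lists S \<and> ev xs = w \<and> length xs = len w"
  by (auto simp: reduced_expression_def expression_def)

lemma len_gen_mult_le: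
  assumes "s \<in> S" "w \<in> carrier W" shows "len (s \<otimes> w) \<le> Suc (len w)"
proof -
  obtain xs where "xs \<in> lists S" "ev xs = w" "length xs = len w" using reduced_word assms by blast
  with len_le[of "s # xs"] assms show ?thesis by auto
qed

lemma len_le_gen_mult: "\<lbrakk>s \<in> S; w \<in> carrier W\<rbrakk> \<Longrightarrow> len w \<le> Suc (len (s \<otimes> w))"
  using len_gen_mult_le[of s "s \<otimes> w"] by simp

lemma len_one [simp]: "len \<one> = 0"
  using len_le[of "[]"] by simp

section \<open>Inversions\<close>

text \<open>For \<open>xs = s\<^sub>1 \<dots> s\<^sub>k\<close> this counts the \<open>i\<close> with \<open>t = s\<^sub>1 \<dots> s\<^sub>i\<^sub>-\<^sub>1 s\<^sub>i s\<^sub>i\<^sub>-\<^sub>1 \<dots> s\<^sub>1\<close>.\<close>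

primrec refl_count :: "'a list \<Rightarrow> 'a \<Rightarrow> nat" where
  "refl_count [] t = 0"
| "refl_count (s # xs) t = of_bool (t = s) + refl_count xs (s \<otimes> t \<otimes> s)"

lemma refl_count_append:
  "\<lbrakk>xs \<in> lists S; ys \<in> lists S; t \<in> carrier W\<rbrakk> \<Longrightarrow>
    refl_count (xs @ ys) t = refl_count xs t + refl_count ys (inv (ev xs) \<otimes> t \<otimes> ev xs)"
proof (induction xs arbitrary: t)
  case (Cons s xs)
  then show ?case by (simp add: inv_mult_group m_assoc)
qed simp

lemma conj_gen_eq_iff:
  assumes "s \<in> S" "x \<in> carrier W" "y \<in> carrier W"
  shows "s \<otimes> x \<otimes> s = y \<longleftrightarrow> x = s \<otimes> y \<otimes> s"
proof -
  have "s \<otimes> (s \<otimes> z \<otimes> s) \<otimes> s = z" if "z \<in> carrier W" for z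
    using that assms by (simp add: m_assoc)
  then show ?thesis using assms by metis
qed

text \<open>The reflections met along \<open>s t s t ...\<close> are \<open>(s t)^i s\<close>.
  Removing the first two letters conjugates by them, which shifts \<open>i\<close> by two.\<close>

lemma refl_count_alternating:
  assumes "s \<in> S" "t \<in> S" "u \<in> carrier W"
  shows "refl_count (concat (replicate k [s, t])) u
    = (\<Sum>i<2 * k. of_bool (u = (s \<otimes> t) [^] i \<otimes> s))"
  using assms(3)
proof (induction k arbitrary: u)
  case (Suc k)
  let ?p = "\<lambda>i::nat. (s \<otimes> t) [^] i \<otimes> s"
  have p2: "s \<otimes> (t \<otimes> ?p i \<otimes> t) \<otimes> s = ?p (i + 2)" for i
  proof -
    have "s \<otimes> (t \<otimes> ?p i \<otimes> t) \<otimes> s = (s \<otimes> t) \<otimes> (s \<otimes> t) [^] i \<otimes> (s \<otimes> t) \<otimes> s"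
      using assms by (simp add: m_assoc)
    also have "\<dots> = ?p (i + 2)"
      using assms nat_pow_Suc2[of "s \<otimes> t" i] by (metis add_2_eq_Suc' gen_closed m_closed nat_pow_Suc)
    finally show ?thesis .
  qed
  have "refl_count (concat (replicate (Suc k) [s, t])) u =
      of_bool (u = s) + (of_bool (s \<otimes> u \<otimes> s = t)
        + refl_count (concat (replicate k [s, t])) (t \<otimes> (s \<otimes> u \<otimes> s) \<otimes> t))"
    by simp
  also have "of_bool (u = s) = (of_bool (u = ?p 0) :: nat)" using assms by simp
  also have "of_bool (s \<otimes> u \<otimes> s = t) = (of_bool (u = ?p 1) :: nat)"
    using assms Suc.prems by (simp add: conj_gen_eq_iff)
  also have "refl_count (concat (replicate k [s, t])) (t \<otimes> (s \<otimes> u \<otimes> s) \<otimes> t)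
      = (\<Sum>i<2 * k. of_bool (t \<otimes> (s \<otimes> u \<otimes> s) \<otimes> t = ?p i))"
    using Suc.IH[of "t \<otimes> (s \<otimes> u \<otimes> s) \<otimes> t"] Suc.prems assms by simp
  also have "\<dots> = (\<Sum>i<2 * k. of_bool (u = ?p (i + 2)))"
    using assms Suc.prems by (simp only: conj_gen_eq_iff m_closed gen_closed nat_pow_closed p2)
  finally show ?case
    by (simp add: sum.lessThan_Suc_shift del: sum.lessThan_Suc nat_pow_Suc)
qed simp

lemma coxeter_cong_lists: "coxeter_cong S m xs ys \<Longrightarrow> xs \<in> lists S \<and> ys \<in> lists S"
  by (induction rule: coxeter_cong.induct) (auto simp: in_lists_conv_set)

lemma coxeter_cong_ev: "coxeter_cong S m xs ys \<Longrightarrow> ev xs = ev ys"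
  using presentation coxeter_cong_lists by blast

lemma ev_alternating:
  "\<lbrakk>s \<in> S; t \<in> S\<rbrakk> \<Longrightarrow> ev (concat (replicate k [s, t])) = (s \<otimes> t) [^] k"
proof (induction k)
  case (Suc k)
  then show ?case using nat_pow_Suc2[of "s \<otimes> t" k] by (simp add: m_assoc del: nat_pow_Suc)
qed simp

text \<open>The essential case is a defining relation. Since \<open>(s s')^k = 1\<close>, the
  reflections \<open>(s s')^i s\<close> have period \<open>k\<close> in \<open>i\<close>, so the sum
  over \<open>i < 2 k\<close> runs twice through the same terms and is even, as for the empty
  word.\<close>

lemma coxeter_cong_refl_count:
  "\<lbrakk>coxeter_cong S m xs ys; t \<in> carrier W\<rbrakk> \<Longrightarrow> even (refl_count xs t) = even (refl_count ys t)"
proof (induction arbitrary: t rule: coxeter_cong.induct)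
  case (rel s s' k)
  have one: "(s \<otimes> s') [^] k = \<one>"
    using coxeter_cong_ev[OF coxeter_cong.rel, of s s' k] rel by (simp add: ev_alternating)
  let ?f = "\<lambda>i. of_bool (t = (s \<otimes> s') [^] i \<otimes> s) :: nat"
  have period: "?f (i + k) = ?f i" for i
    using one rel by (simp add: nat_pow_mult[symmetric])
  have "(\<Sum>i<k + j. ?f i) = (\<Sum>i<k. ?f i) + (\<Sum>i<j. ?f (i + k))" for j
    by (induction j) (simp_all add: add.commute)
  from this[of k] have "(\<Sum>i<k + k. ?f i) = (\<Sum>i<k. ?f i) + (\<Sum>i<k. ?f i)"
    unfolding period .
  then have "even (\<Sum>i<k + k. ?f i)" by presburger
  with rel show ?case by (simp add: refl_count_alternating flip: mult_2)
next
  case (append xs xs' ys ys')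
  have "xs \<in> lists S" "xs' \<in> lists S" "ys \<in> lists S" "ys' \<in> lists S"
    using append.hyps coxeter_cong_lists by blast+
  moreover have "ev xs = ev xs'" using append.hyps coxeter_cong_ev by blast
  ultimately show ?case
    using append.IH(1)[of t] append.IH(2)[of "inv (ev xs') \<otimes> t \<otimes> ev xs'"] append.prems
    by (simp add: refl_count_append)
qed auto

text \<open>These are the left inversions of \<open>w\<close>, the reflections that shorten it from
  the left. Since the parity is the same for all words of \<open>w\<close>, any single word decides
  membership.\<close>

definition inversions :: "'a \<Rightarrow> 'a set" where
  "inversions w = {t \<in> carrier W. \<exists>xs\<in>lists S. ev xs = w \<and> odd (refl_count xs t)}"

lemma inversions_closed: "t \<in> inversions w \<Longrightarrow> t \<in> carrier W"
  by (simp add: inversions_def)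

lemma inversions_ev:
  "\<lbrakk>xs \<in> lists S; t \<in> carrier W\<rbrakk> \<Longrightarrow> t \<in> inversions (ev xs) \<longleftrightarrow> odd (refl_count xs t)"
  unfolding inversions_def using presentation coxeter_cong_refl_count by blast

lemma inversions_one [simp]: "inversions \<one> = {}"
proof -
  have "t \<notin> inversions \<one>" for t
    using inversions_ev[of "[]" t] inversions_closed[of t "\<one>"] by auto
  then show ?thesis by blast
qed

text \<open>This is the cocycle rule: the inversions of \<open>x \<otimes> y\<close> are the
  symmetric difference of those of \<open>x\<close> and the conjugates by \<open>x\<close> of those
  of \<open>y\<close>. It follows from counting along a concatenated word.\<close>

lemma inversions_mult:
  assumes "x \<in> carrier W" "y \<in> carrier W" "t \<in> carrier W"
  shows "t \<in> inversions (x \<otimes> y) \<longleftrightarrow> (t \<in> inversions x) \<noteq> (inv x \<otimes> t \<otimes> x \<in> inversions y)"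
proof -
  obtain xs ys where xs: "xs \<in> lists S" "x = ev xs" and ys: "ys \<in> lists S" "y = ev ys"
    using assms carrier_word by metis
  have "t \<in> inversions (ev (xs @ ys)) \<longleftrightarrow> odd (refl_count (xs @ ys) t)"
    using assms xs ys by (intro inversions_ev) auto
  then show ?thesis
    using assms xs ys by (auto simp: refl_count_append ev_append inversions_ev)
qed

lemma inversions_gen:
  assumes "s \<in> S" "t \<in> carrier W"
  shows "t \<in> inversions s \<longleftrightarrow> t = s"
  using inversions_ev[of "[s]" t] assms by simp

lemma inversions_gen_mult:
  assumes "s \<in> S" "w \<in> carrier W"
  shows "s \<in> inversions (s \<otimes> w) \<longleftrightarrow> s \<notin> inversions w"
  using assms by (simp add: inversions_mult inversions_gen)

lemma refl_count_split:
  "\<lbrakk>xs \<in> lists S; t \<in> carrier W; refl_count xs t \<noteq> 0\<rbrakk> \<Longrightarrow>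
    \<exists>as s bs. xs = as @ s # bs \<and> t = ev as \<otimes> s \<otimes> inv (ev as)"
proof (induction xs arbitrary: t)
  case (Cons s xs)
  show ?case
  proof (cases "t = s")
    case True
    then show ?thesis using Cons.prems by (intro exI[of _ "[]"]) auto
  next
    case False
    with Cons.prems Cons.IH[of "s \<otimes> t \<otimes> s"] obtain as s' bs
      where *: "xs = as @ s' # bs" "s \<otimes> t \<otimes> s = ev as \<otimes> s' \<otimes> inv (ev as)" by auto
    then have "t = s \<otimes> (ev as \<otimes> s' \<otimes> inv (ev as)) \<otimes> s"
      using Cons.prems by (subst (asm) conj_gen_eq_iff) auto
    also have "\<dots> = ev (s # as) \<otimes> s' \<otimes> inv (ev (s # as))"
      using Cons.prems * by (simp add: inv_mult_group m_assoc)
    finally show ?thesis using * by (intro exI[of _ "s # as"]) auto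
  qed
qed simp

text \<open>Strong exchange: an odd count is nonzero, so \<open>t\<close> occurs among the
  reflections along the word, and multiplying by it deletes the letter at that place.\<close>

lemma exchange:
  assumes "xs \<in> lists S" "t \<in> inversions (ev xs)"
  obtains as s bs where "xs = as @ s # bs" "t = ev as \<otimes> s \<otimes> inv (ev as)"
    "t \<otimes> ev xs = ev (as @ bs)"
proof -
  have t: "t \<in> carrier W" using assms inversions_closed by blast
  then have "refl_count xs t \<noteq> 0" using assms inversions_ev by (metis odd_pos not_gr_zero)
  from refl_count_split[OF assms(1) t this] obtain as s bs
    where *: "xs = as @ s # bs" "t = ev as \<otimes> s \<otimes> inv (ev as)" by blast
  have "t \<otimes> ev xs = ev (as @ bs)"
    using assms * ev_append[of as "s # bs"] by (simp add: ev_append m_assoc)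
  with * that show ?thesis by blast
qed

lemma inversion_len_less:
  assumes "w \<in> carrier W" "t \<in> inversions w"
  shows "len (t \<otimes> w) < len w"
proof -
  obtain xs where xs: "xs \<in> lists S" "ev xs = w" "length xs = len w"
    using reduced_word assms by blast
  from xs assms exchange[of xs t] obtain as s bs
    where "xs = as @ s # bs" "t \<otimes> w = ev (as @ bs)" by metis
  with len_le[of "as @ bs"] xs show ?thesis by auto
qed

lemma conj_square:
  assumes "a \<in> carrier W" "s \<in> S"
  shows "(inv a \<otimes> s \<otimes> a) \<otimes> (inv a \<otimes> s \<otimes> a) = \<one>"
  using assms by (simp add: m_assoc)

text \<open>Apply the cocycle rule to \<open>inv a \<otimes> a\<close> and to
  \<open>inv a \<otimes> (s \<otimes> a)\<close>. The answers differ because exactly one of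
  \<open>a\<close> and \<open>s \<otimes> a\<close> has \<open>s\<close> as an inversion, and the
  first product is \<open>\<one>\<close>, which has no inversions.\<close>

lemma reflection_inversion_self:
  assumes "a \<in> carrier W" "s \<in> S"
  shows "inv a \<otimes> s \<otimes> a \<in> inversions (inv a \<otimes> s \<otimes> a)" (is "?t \<in> _")
proof -
  have "a \<otimes> (inv a \<otimes> s \<otimes> a) \<otimes> inv a = s"
    using assms by (simp add: m_assoc)
  moreover have "?t \<in> inversions (inv a \<otimes> a) \<longleftrightarrow>
      (?t \<in> inversions (inv a)) \<noteq> (a \<otimes> ?t \<otimes> inv a \<in> inversions a)"
    using inversions_mult[of "inv a" a ?t] assms by simp
  moreover have "?t \<in> inversions (inv a \<otimes> (s \<otimes> a)) \<longleftrightarrow>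
      (?t \<in> inversions (inv a)) \<noteq> (a \<otimes> ?t \<otimes> inv a \<in> inversions (s \<otimes> a))"
    using inversions_mult[of "inv a" "s \<otimes> a" ?t] assms by simp
  moreover have "inv a \<otimes> (s \<otimes> a) = ?t" "inv a \<otimes> a = \<one>" using assms by (simp_all add: m_assoc)
  ultimately show ?thesis using assms inversions_gen_mult[of s a] by auto
qed

text \<open>A reflection is an inversion of itself, so multiplying \<open>w\<close> by it makes it
  an inversion of the product; strong exchange then shortens the product back to
  \<open>w\<close>.\<close>

lemma not_inversion_len_less:
  assumes "a \<in> carrier W" "s \<in> S" "w \<in> carrier W" "inv a \<otimes> s \<otimes> a \<notin> inversions w"
  shows "len w < len ((inv a \<otimes> s \<otimes> a) \<otimes> w)"
proof -
  let ?t = "inv a \<otimes> s \<otimes> a"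
  have t: "?t \<in> carrier W" "?t \<otimes> ?t = \<one>" using assms conj_square by auto
  then have "inv ?t = ?t" by (simp add: inv_equality)
  then have "inv ?t \<otimes> ?t \<otimes> ?t = ?t" using t by simp
  then have "?t \<in> inversions (?t \<otimes> w)"
    using inversions_mult[OF t(1) assms(3) t(1)] reflection_inversion_self[OF assms(1,2)] assms(4)
    by simp
  then have "len (?t \<otimes> (?t \<otimes> w)) < len (?t \<otimes> w)"
    using t assms by (intro inversion_len_less) auto
  moreover have "?t \<otimes> (?t \<otimes> w) = w" using t assms by (metis m_assoc l_one)
  ultimately show ?thesis by simp
qed

lemma len_gen_mult:
  assumes "s \<in> S" "w \<in> carrier W"
  shows "s \<in> inversions w \<Longrightarrow> len w = Suc (len (s \<otimes> w))"
    and "s \<notin> inversions w \<Longrightarrow> len (s \<otimes> w) = Suc (len w)"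
proof -
  assume "s \<in> inversions w"
  then show "len w = Suc (len (s \<otimes> w))"
    using assms inversion_len_less[of w s] len_le_gen_mult[of s w] by linarith
next
  assume "s \<notin> inversions w"
  then have "len (s \<otimes> (s \<otimes> w)) < len (s \<otimes> w)"
    using assms by (intro inversion_len_less) (simp_all add: inversions_gen_mult)
  then show "len (s \<otimes> w) = Suc (len w)"
    using assms len_gen_mult_le[of s w] by simp
qed

lemma gen_inversion_iff:
  "\<lbrakk>s \<in> S; w \<in> carrier W\<rbrakk> \<Longrightarrow> s \<in> inversions w \<longleftrightarrow> len (s \<otimes> w) < len w"
  using inversion_len_less[of w s] len_gen_mult(2)[of s w] by (cases "s \<in> inversions w") auto

section \<open>Bruhat order as reachability along reflections\<close>

text \<open>The reflexive transitive closure of these steps is the reflection form of the Bruhat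
  order. It is easier to follow under multiplication by a generator than the subword form.\<close>

definition bruhat_step :: "'a \<Rightarrow> 'a \<Rightarrow> bool" where
  "bruhat_step x y \<longleftrightarrow> y \<in> carrier W \<and> (\<exists>t\<in>inversions y. x = t \<otimes> y)"

abbreviation bruhat_chain :: "'a \<Rightarrow> 'a \<Rightarrow> bool" where
  "bruhat_chain \<equiv> bruhat_step\<^sup>*\<^sup>*"

definition down :: "'a \<Rightarrow> 'a \<Rightarrow> 'a" where
  "down s w = (if s \<in> inversions w then s \<otimes> w else w)"

definition up :: "'a \<Rightarrow> 'a \<Rightarrow> 'a" where
  "up s w = (if s \<in> inversions w then w else s \<otimes> w)"

lemma bruhat_step_closed:
  "bruhat_step x y \<Longrightarrow> x \<in> carrier W" "bruhat_step x y \<Longrightarrow> y \<in> carrier W"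
  by (auto simp: bruhat_step_def inversions_closed)

lemma bruhat_step_gen:
  assumes "s \<in> S" "w \<in> carrier W"
  shows "s \<in> inversions w \<Longrightarrow> bruhat_step (s \<otimes> w) w"
    and "s \<notin> inversions w \<Longrightarrow> bruhat_step w (s \<otimes> w)"
  using assms unfolding bruhat_step_def
  by (auto intro!: bexI[of _ s] simp: inversions_gen_mult)

text \<open>Conjugation by \<open>s\<close> turns \<open>x = t \<otimes> y\<close> into a relation
  between \<open>s \<otimes> x\<close> and \<open>s \<otimes> y\<close>. The excluded case is
  \<open>t = s\<close>; otherwise \<open>s \<otimes> t \<otimes> s\<close> differs from
  \<open>s\<close>, and the cocycle rule makes it an inversion of
  \<open>s \<otimes> y\<close>.\<close>

lemma bruhat_step_gen_mult:
  assumes "s \<in> S" "bruhat_step x y" "s \<otimes> x \<noteq> y"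
  shows "bruhat_step (s \<otimes> x) (s \<otimes> y)"
proof -
  from assms obtain t where t: "y \<in> carrier W" "t \<in> inversions y" "x = t \<otimes> y"
    unfolding bruhat_step_def by blast
  have tc: "t \<in> carrier W" using t inversions_closed by blast
  have "t \<noteq> s" using assms t by auto
  then have "s \<otimes> t \<otimes> s \<noteq> s" using assms tc conj_gen_eq_iff[of s t s] by (auto simp: m_assoc)
  moreover have "s \<otimes> (s \<otimes> t \<otimes> s) \<otimes> s = t" using assms tc by (simp add: m_assoc)
  ultimately have "s \<otimes> t \<otimes> s \<in> inversions (s \<otimes> y)"
    using assms t tc inversions_mult[of s y "s \<otimes> t \<otimes> s"] by (simp add: inversions_gen)
  moreover have "s \<otimes> x = s \<otimes> t \<otimes> s \<otimes> (s \<otimes> y)" using assms t tc by (simp add: m_assoc)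
  ultimately show ?thesis using assms t unfolding bruhat_step_def by auto
qed

text \<open>Here \<open>down s\<close> and \<open>up s\<close> choose the shorter and the longer of
  \<open>w\<close> and \<open>s \<otimes> w\<close>. If \<open>s\<close> interchanges
  \<open>x\<close> and \<open>y\<close>, the choices coincide. Otherwise the step carries over to
  \<open>s \<otimes> x\<close> and \<open>s \<otimes> y\<close>, and the mixed cases are joined by a
  step along \<open>s\<close>.\<close>

lemma
  assumes "s \<in> S" "bruhat_step x y"
  shows bruhat_step_down: "bruhat_chain (down s x) (down s y)"
    and bruhat_step_up: "bruhat_chain (up s x) (up s y)"
proof -
  have c: "x \<in> carrier W" "y \<in> carrier W" using assms bruhat_step_closed by auto
  have "bruhat_chain (down s x) (down s y) \<and> bruhat_chain (up s x) (up s y)"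
  proof (cases "s \<otimes> x = y")
    case True
    then have "down s x = down s y" "up s x = up s y"
      using assms c inversions_gen_mult[of s x] by (auto simp: down_def up_def)
    then show ?thesis by simp
  next
    case False
    note * = bruhat_step_gen_mult[OF assms False]
    show ?thesis
      unfolding down_def up_def
      using * assms(2) bruhat_step_gen[OF assms(1) c(1)] bruhat_step_gen[OF assms(1) c(2)]
      by (auto intro: converse_rtranclp_into_rtranclp)
  qed
  then show "bruhat_chain (down s x) (down s y)" "bruhat_chain (up s x) (up s y)" by auto
qed

lemma bruhat_chain_down:
  assumes "s \<in> S" "bruhat_chain x y"
  shows "bruhat_chain (down s x) (down s y)"
  using assms(2) by induction (auto intro: rtranclp_trans bruhat_step_down[OF assms(1)])

lemma bruhat_chain_up:
  assumes "s \<in> S" "bruhat_chain x y"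
  shows "bruhat_chain (up s x) (up s y)"
  using assms(2) by induction (auto intro: rtranclp_trans bruhat_step_up[OF assms(1)])

lemma bruhat_chain_one: "bruhat_chain x \<one> \<Longrightarrow> x = \<one>"
  by (erule rtranclp.cases) (auto simp: bruhat_step_def)

lemma reduced_Cons:
  assumes "s \<in> S" "xs \<in> lists S" "length (s # xs) = len (ev (s # xs))"
  shows "length xs = len (ev xs)" "s \<notin> inversions (ev xs)"
proof -
  have "Suc (length xs) \<le> Suc (len (ev xs))"
    using assms len_gen_mult_le[of s "ev xs"] by simp
  then show *: "length xs = len (ev xs)" using assms len_le[of xs] by simp
  show "s \<notin> inversions (ev xs)"
    using assms * len_gen_mult(1)[of s "ev xs"] by auto
qed

lemma subseq_lists: "\<lbrakk>subseq ys xs; xs \<in> lists A\<rbrakk> \<Longrightarrow> ys \<in> lists A"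
  by (induction rule: list_emb.induct) auto

text \<open>Along a reduced word, prepending \<open>s\<close> is the monotone map
  \<open>up s\<close>. For a subword that keeps \<open>s\<close>, the value
  \<open>s \<otimes> ev zs\<close> is at most \<open>up s (ev zs)\<close>.\<close>

lemma subseq_bruhat_chain:
  "\<lbrakk>xs \<in> lists S; length xs = len (ev xs); subseq ys xs\<rbrakk> \<Longrightarrow> bruhat_chain (ev ys) (ev xs)"
proof (induction xs arbitrary: ys)
  case Nil
  then have "ys = []" using list_emb_Nil2 by blast
  then show ?case by simp
next
  case (Cons s xs)
  then have s: "s \<in> S" "xs \<in> lists S" by auto
  note red = reduced_Cons[OF s Cons.prems(2)]
  have up: "up s (ev xs) = s \<otimes> ev xs" using red by (simp add: up_def)
  from Cons.prems(3) consider (drop) "subseq ys xs" | (keep) zs where "ys = s # zs" "subseq zs xs"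
    by (cases rule: list_emb.cases) auto
  then show ?case
  proof cases
    case zs: keep
    then have "zs \<in> lists S" using s subseq_lists by blast
    then have "bruhat_chain (s \<otimes> ev zs) (up s (ev zs))"
      using s bruhat_step_gen(1)[of s "ev zs"] r_into_rtranclp[of bruhat_step] by (simp add: up_def)
    also have "bruhat_chain (up s (ev zs)) (up s (ev xs))"
      using Cons.IH[OF s(2) red(1) zs(2)] s by (intro bruhat_chain_up) auto
    finally show ?thesis using zs up by simp
  next
    case drop
    with Cons.IH[OF s(2) red(1)] have "bruhat_chain (ev ys) (ev xs)" by blast
    also have "bruhat_step (ev xs) (s \<otimes> ev xs)" using s red bruhat_step_gen(2) by blast
    finally show ?thesis by simp
  qed
qed

lemma bruhat_le_imp_chain: "bruhat_le W S v w \<Longrightarrow> bruhat_chain v w"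
  using subseq_bruhat_chain unfolding bruhat_le_def reduced_expression_iff by metis

section \<open>Parabolic subgroups\<close>

lemma generate_closed: "J \<subseteq> S \<Longrightarrow> generate W J \<subseteq> carrier W"
  using gens_closed by (intro generate_incl) blast

text \<open>Take a shortest word over \<open>J\<close> itself. If its first letter shortened the
  rest, exchange would delete a letter and leave a shorter word, still over \<open>J\<close>. This
  links the length over \<open>S\<close> to words over \<open>J\<close>.\<close>

lemma generate_descent:
  assumes "J \<subseteq> S" "x \<in> generate W J" "x \<noteq> \<one>"
  obtains s y where "s \<in> J" "y \<in> generate W J" "x = s \<otimes> y" "s \<in> inversions x" "s \<notin> inversions y"
    "len x = Suc (len y)"
proof -
  have "\<exists>xs. xs \<in> lists J \<and> ev xs = x" using assms generate_words by auto
  then obtain xs where xs: "xs \<in> lists J" "ev xs = x"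
    and min: "\<And>ys. \<lbrakk>ys \<in> lists J; ev ys = x\<rbrakk> \<Longrightarrow> length xs \<le> length ys"
    using ex_has_least_nat[of "\<lambda>xs. xs \<in> lists J \<and> ev xs = x" _ length] by metis
  then obtain s zs where szs: "xs = s # zs" using assms by (cases xs) auto
  have sz: "s \<in> J" "zs \<in> lists J" "s \<in> S" "zs \<in> lists S" using xs szs assms by auto
  have "s \<notin> inversions (ev zs)"
  proof
    assume "s \<in> inversions (ev zs)"
    then obtain as u bs where *: "zs = as @ u # bs" "s \<otimes> ev zs = ev (as @ bs)"
      using exchange sz by metis
    then have "length xs \<le> length (as @ bs)"
      using xs szs sz by (intro min) auto
    then show False using * szs by simp
  qed
  moreover have "ev zs \<in> generate W J" using sz generate_words[OF assms(1)] by auto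
  ultimately show ?thesis
    using that[of s "ev zs"] xs szs sz len_gen_mult(2)[of s "ev zs"] inversions_gen_mult[of s "ev zs"]
    by auto
qed

lemma generate_len_induct [consumes 2, case_names one gen]:
  assumes "J \<subseteq> S" "x \<in> generate W J"
    and "P \<one>" "\<And>s y. \<lbrakk>s \<in> J; y \<in> generate W J; s \<notin> inversions y; P y\<rbrakk> \<Longrightarrow> P (s \<otimes> y)"
  shows "P x"
  using assms(2)
proof (induction "len x" arbitrary: x rule: less_induct)
  case less
  show ?case
  proof (cases "x = \<one>")
    case False
    with generate_descent[OF assms(1) less.prems] obtain s y where
      "s \<in> J" "y \<in> generate W J" "x = s \<otimes> y" "s \<notin> inversions y" "len x = Suc (len y)" by metis
    with less.hyps[of y] assms(4) show ?thesis by simp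
  qed (use assms in simp)
qed

lemma conj_in_generate:
  assumes "J \<subseteq> S" "y \<in> generate W J" "s \<in> J"
  shows "inv y \<otimes> s \<otimes> y \<in> generate W J"
proof -
  have "J \<subseteq> carrier W" using assms gens_closed by blast
  with assms show ?thesis
    by (intro generate.eng generate_m_inv_closed) (auto intro: generate.incl)
qed

section \<open>Additivity of length on cosets of parabolic subgroups\<close>

text \<open>A letter \<open>s\<close> that lengthens \<open>y\<close> also lengthens
  \<open>y \<otimes> b\<close>: otherwise the cocycle rule makes
  \<open>inv y \<otimes> s \<otimes> y\<close> an inversion of \<open>b\<close>, and multiplying by
  it gives a shorter element of the same coset.\<close>

lemma len_mult_minimal:
  assumes J: "J \<subseteq> S" and b: "b \<in> carrier W"
    and min: "\<And>x. x \<in> generate W J \<Longrightarrow> len b \<le> len (x \<otimes> b)" and x: "x \<in> generate W J"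
  shows "len (x \<otimes> b) = len x + len b"
  using J x
proof (induction rule: generate_len_induct)
  case (gen s y)
  then have c: "s \<in> S" "y \<in> carrier W" using J generate_closed by auto
  have "inv y \<otimes> s \<otimes> y \<notin> inversions b"
    using min[OF conj_in_generate[OF J gen(2,1)]] inversion_len_less[OF b] by fastforce
  then have "s \<notin> inversions (y \<otimes> b)" using gen c b inversions_mult[of y b s] by simp
  then show ?case using gen c b by (simp add: len_gen_mult(2) m_assoc)
qed (use b in simp)

text \<open>Dually, each reflection \<open>inv y \<otimes> s \<otimes> y\<close> is an inversion of
  \<open>w\<close>, since it would otherwise lengthen \<open>w\<close> beyond the maximum. So a
  letter that lengthens \<open>y\<close> shortens \<open>y \<otimes> w\<close>.\<close>

lemma len_mult_maximal:
  assumes J: "J \<subseteq> S" and w: "w \<in> generate W J"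
    and max: "\<And>x. x \<in> generate W J \<Longrightarrow> len x \<le> len w" and x: "x \<in> generate W J"
  shows "len (x \<otimes> w) + len x = len w"
  using J x
proof (induction rule: generate_len_induct)
  case one
  have "w \<in> carrier W" using w generate_closed[OF J] by blast
  then show ?case by simp
next
  case (gen s y)
  then have c: "s \<in> S" "y \<in> carrier W" "w \<in> carrier W" using J w generate_closed by auto
  have "len (inv y \<otimes> s \<otimes> y \<otimes> w) \<le> len w"
    using generate.eng[OF conj_in_generate[OF J gen(2,1)] w] by (rule max)
  then have "inv y \<otimes> s \<otimes> y \<in> inversions w"
    using not_inversion_len_less[of y s w] c by fastforce
  then have "s \<in> inversions (y \<otimes> w)" using gen c inversions_mult[of y w s] by simp
  then have "len (y \<otimes> w) = Suc (len (s \<otimes> (y \<otimes> w)))" using c len_gen_mult(1) by simp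
  then show ?case using gen c by (simp add: len_gen_mult(2) m_assoc)
qed

text \<open>A shortest element of the coset of \<open>u\<close> serves as \<open>b\<close>.\<close>

lemma coset_minimal:
  assumes J: "J \<subseteq> S" and u: "u \<in> carrier W"
  obtains a b where "a \<in> generate W J" "b \<in> carrier W" "u = a \<otimes> b"
    "\<And>x. x \<in> generate W J \<Longrightarrow> len (x \<otimes> b) = len x + len b"
proof -
  have "\<exists>b. \<exists>c\<in>generate W J. b = c \<otimes> u" using generate.one by blast
  then obtain b c where c: "c \<in> generate W J" "b = c \<otimes> u"
    and min: "\<And>d. d \<in> generate W J \<Longrightarrow> len b \<le> len (d \<otimes> u)"
    using ex_has_least_nat[of "\<lambda>b. \<exists>c\<in>generate W J. b = c \<otimes> u" _ len] by metis
  have JC: "J \<subseteq> carrier W" using J gens_closed by blast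
  have cc: "c \<in> carrier W" using c J generate_closed by blast
  then have bc: "b \<in> carrier W" using c u by simp
  have "len b \<le> len (x \<otimes> b)" if "x \<in> generate W J" for x
    using min[of "x \<otimes> c"] that c cc u generate_closed[OF J]
    by (auto simp: m_assoc subset_iff intro: generate.eng)
  then have "len (x \<otimes> b) = len x + len b" if "x \<in> generate W J" for x
    using len_mult_minimal[OF J bc] that by blast
  moreover have "u = inv c \<otimes> b" using c cc u by simp
  moreover have "inv c \<in> generate W J" using generate_m_inv_closed[OF JC] c by blast
  ultimately show ?thesis using that bc by blast
qed

text \<open>In \<open>u = a \<otimes> b\<close> with \<open>b\<close> minimal, a first letter
  shortening \<open>a\<close> would shorten \<open>u\<close> by additivity; so
  \<open>a = \<one>\<close> and \<open>u\<close> is the minimal representative. A condition on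
  single letters thus yields additivity for all of \<open>generate W J\<close>.\<close>

lemma len_mult_no_descents:
  assumes J: "J \<subseteq> S" and u: "u \<in> carrier W" and "\<And>s. s \<in> J \<Longrightarrow> s \<notin> inversions u"
    and x: "x \<in> generate W J"
  shows "len (x \<otimes> u) = len x + len u"
proof -
  obtain a b where ab: "a \<in> generate W J" "b \<in> carrier W" "u = a \<otimes> b"
    "\<And>x. x \<in> generate W J \<Longrightarrow> len (x \<otimes> b) = len x + len b"
    using coset_minimal[OF J u] by metis
  have "a = \<one>"
  proof (rule ccontr)
    assume "a \<noteq> \<one>"
    with generate_descent[OF J ab(1)] obtain s y where
      *: "s \<in> J" "y \<in> generate W J" "a = s \<otimes> y" "len a = Suc (len y)" by metis
    then have c: "s \<in> S" "y \<in> carrier W" using J generate_closed by auto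
    then have "s \<otimes> u = y \<otimes> b" using ab * by (simp add: m_assoc)
    then have "len (s \<otimes> u) < len u" using ab * by simp
    then show False using assms(3)[OF *(1)] gen_inversion_iff c u by simp
  qed
  then show ?thesis using ab x by simp
qed

text \<open>Writing \<open>a = x w\<close>, a letter \<open>s\<close> that shortens \<open>x\<close> would lengthen \<open>a\<close>.\<close>

lemma all_descents_maximal:
  assumes J: "J \<subseteq> S" and w: "w \<in> generate W J"
    and max: "\<And>x. x \<in> generate W J \<Longrightarrow> len x \<le> len w"
    and a: "a \<in> generate W J" and desc: "\<And>s. s \<in> J \<Longrightarrow> s \<in> inversions a"
  shows "a = w"
proof -
  have JC: "J \<subseteq> carrier W" using J gens_closed by blast
  have c: "a \<in> carrier W" "w \<in> carrier W" using a w J generate_closed by auto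
  define x where "x = a \<otimes> inv w"
  have x: "x \<in> generate W J" unfolding x_def using a w generate_m_inv_closed[OF JC]
    by (blast intro: generate.eng)
  have ax: "a = x \<otimes> w" using c by (simp add: x_def m_assoc)
  have "x = \<one>"
  proof (rule ccontr)
    assume "x \<noteq> \<one>"
    with generate_descent[OF J x] obtain s y where
      *: "s \<in> J" "y \<in> generate W J" "x = s \<otimes> y" "len x = Suc (len y)" by metis
    then have c': "s \<in> S" "y \<in> carrier W" using J generate_closed by auto
    then have "s \<otimes> a = y \<otimes> w" using ax * c by (simp add: m_assoc)
    moreover have "len (y \<otimes> w) + len y = len w"
      using len_mult_maximal[OF J w max *(2)] .
    moreover have "len a + len x = len w"
      using len_mult_maximal[OF J w max x] ax by simp
    ultimately have "len a < len (s \<otimes> a)" using * by simp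
    then show False using desc[OF *(1)] gen_inversion_iff c c' by fastforce
  qed
  then show ?thesis using ax c by simp
qed

text \<open>Apply the monotone map \<open>down s\<close> to both sides, with \<open>s\<close> a
  descent of \<open>a\<close> or of \<open>b\<close>. Neither factor gets longer and at least one
  gets shorter, so both eventually reach \<open>\<one>\<close>.\<close>

lemma bruhat_chain_minimal:
  assumes J: "J \<subseteq> S"
    and "a \<in> generate W J" "b \<in> generate W J" "x \<in> carrier W" "y \<in> carrier W"
    and x: "\<And>s. s \<in> J \<Longrightarrow> s \<notin> inversions x" and y: "\<And>s. s \<in> J \<Longrightarrow> s \<notin> inversions y"
    and "bruhat_chain (a \<otimes> x) (b \<otimes> y)"
  shows "bruhat_chain x y"
  using assms(2,3,8)
proof (induction "len a + len b" arbitrary: a b rule: less_induct)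
  case less
  have lenx: "len (c \<otimes> x) = len c + len x" "len (c \<otimes> y) = len c + len y"
    if "c \<in> generate W J" for c
    using len_mult_no_descents[OF J] that assms by blast+
  \<comment> \<open>By additivity of length, \<open>down s\<close> acts on
    \<open>c \<otimes> z\<close> through the factor \<open>c\<close> alone.\<close>
  have down: "\<exists>c'\<in>generate W J. down s (c \<otimes> z) = c' \<otimes> z \<and> len c' \<le> len c \<and>
      (s \<in> inversions c \<longrightarrow> len c' < len c)"
    if s: "s \<in> J" and c: "c \<in> generate W J" and z: "z = x \<or> z = y" for s c z
  proof -
    have *: "s \<in> S" "c \<in> carrier W" "z \<in> carrier W" "s \<otimes> c \<in> generate W J"
      using s c z J generate_closed assms(4,5) by (auto intro: generate.eng generate.incl)
    have "len (c \<otimes> z) = len c + len z" "len (s \<otimes> c \<otimes> z) = len (s \<otimes> c) + len z"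
      using lenx z * c by auto
    then have "s \<in> inversions (c \<otimes> z) \<longleftrightarrow> s \<in> inversions c"
      using * gen_inversion_iff by (simp add: m_assoc)
    then show ?thesis
      using * c gen_inversion_iff[of s c] unfolding down_def
      by (cases "s \<in> inversions c") (force simp: m_assoc intro!: bexI[of _ "s \<otimes> c"], force)
  qed
  show ?case
  proof (cases "a = \<one> \<and> b = \<one>")
    case True
    then show ?thesis using less.prems assms by simp
  next
    case False
    then obtain s where s: "s \<in> J" "s \<in> inversions a \<or> s \<in> inversions b"
      using generate_descent[OF J] less.prems by metis
    then obtain a' b' where a': "a' \<in> generate W J" "down s (a \<otimes> x) = a' \<otimes> x" "len a' \<le> len a"
        "s \<in> inversions a \<longrightarrow> len a' < len a"
      and b': "b' \<in> generate W J" "down s (b \<otimes> y) = b' \<otimes> y" "len b' \<le> len b"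
        "s \<in> inversions b \<longrightarrow> len b' < len b"
      using down less.prems by metis
    have "bruhat_chain (a' \<otimes> x) (b' \<otimes> y)"
      using bruhat_chain_down[of s, OF _ less.prems(3)] a'(2) b'(2) s(1) J by (simp add: subset_iff)
    moreover have "len a' + len b' < len a + len b" using a' b' s by auto
    ultimately show ?thesis using less.hyps a' b' by blast
  qed
qed

text \<open>Applied to a word over \<open>J\<close>, exchange writes \<open>t\<close> as a conjugate
  of a letter by a prefix, and all letters involved lie in \<open>J\<close>.\<close>

lemma inversions_generate:
  assumes J: "J \<subseteq> S" and "x \<in> generate W J" "t \<in> inversions x"
  shows "t \<in> generate W J"
proof -
  obtain xs where xs: "xs \<in> lists J" "x = ev xs" using assms generate_words by auto
  moreover have "xs \<in> lists S" using xs J by auto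
  ultimately obtain as s bs where *: "xs = as @ s # bs" "t = ev as \<otimes> s \<otimes> inv (ev as)"
    using exchange assms by metis
  then have "as \<in> lists J" "s \<in> J" using xs by auto
  then have "ev as \<in> generate W J" "s \<in> generate W J"
    using generate_words[OF J] by (auto intro: generate.incl)
  then show ?thesis
    using * generate_m_inv_closed[of J] gens_closed J by (auto intro!: generate.eng)
qed

lemma bruhat_le_refl_one: "bruhat_le W S \<one> \<one>"
  unfolding bruhat_le_def reduced_expression_iff by (auto intro!: exI[of _ "[]"])

text \<open>These two rules rebuild the subword form of the order letter by letter: \<open>s\<close>
  is prepended to the reduced word of \<open>w\<close>, and to that of \<open>v\<close> or
  not.\<close>

lemma bruhat_le_gen_mult:
  assumes "bruhat_le W S v w" "s \<in> S" "s \<notin> inversions w"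
  shows "bruhat_le W S v (s \<otimes> w)"
    and "s \<notin> inversions v \<Longrightarrow> bruhat_le W S (s \<otimes> v) (s \<otimes> w)"
proof -
  from assms(1) obtain xs ys where *: "xs \<in> lists S" "ev xs = w" "length xs = len w"
    "subseq ys xs" "ys \<in> lists S" "ev ys = v" "length ys = len v"
    unfolding bruhat_le_def reduced_expression_iff by blast
  have red: "reduced_expression W S (s # xs) (s \<otimes> w)"
    using * assms len_gen_mult(2)[of s w] ev_closed[of xs] by (auto simp: reduced_expression_iff)
  then show "bruhat_le W S v (s \<otimes> w)"
    using * unfolding bruhat_le_def
    by (intro exI[of _ "s # xs"] exI[of _ ys]) (simp add: reduced_expression_iff list_emb_Cons)
  assume "s \<notin> inversions v"
  then have "reduced_expression W S (s # ys) (s \<otimes> v)"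
    using * assms len_gen_mult(2)[of s v] ev_closed[of ys] by (auto simp: reduced_expression_iff)
  with red show "bruhat_le W S (s \<otimes> v) (s \<otimes> w)"
    using * unfolding bruhat_le_def by (intro exI[of _ "s # xs"] exI[of _ "s # ys"]) simp
qed

end

section \<open>Automorphisms and orbits\<close>

locale coxeter_automorphisms = coxeter W S m
  for W :: "('a, 'c) monoid_scheme" (structure) and S m +
  fixes G :: "('a \<Rightarrow> 'a) set"
  assumes automorphisms: "generator_automorphism_group W S G"
begin

lemma aut_hom: "g \<in> G \<Longrightarrow> g \<in> hom W W"
  using automorphisms subgroup.subset
  unfolding generator_automorphism_group_def AutoGroup_def auto_def by fastforce

lemma aut_Bij: "g \<in> G \<Longrightarrow> g \<in> Bij (carrier W)"
  using automorphisms subgroup.subset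
  unfolding generator_automorphism_group_def AutoGroup_def auto_def by fastforce

lemma aut_group_hom: "g \<in> G \<Longrightarrow> group_hom W W g"
  using aut_hom group_axioms by (simp add: group_hom_def group_hom_axioms_def)

lemma aut_mult: "\<lbrakk>g \<in> G; x \<in> carrier W; y \<in> carrier W\<rbrakk> \<Longrightarrow> g (x \<otimes> y) = g x \<otimes> g y"
  using aut_hom hom_mult by metis

lemma aut_closed: "\<lbrakk>g \<in> G; x \<in> carrier W\<rbrakk> \<Longrightarrow> g x \<in> carrier W"
  using aut_hom hom_in_carrier by metis

lemma aut_gen: "\<lbrakk>g \<in> G; s \<in> S\<rbrakk> \<Longrightarrow> g s \<in> S"
  using automorphisms unfolding generator_automorphism_group_def by blast

text \<open>The product of \<open>AutoGroup W\<close> is composition restricted to the carrier, so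
  the pointwise equation is stated there.\<close>

lemma aut_compose:
  assumes "g \<in> G" "h \<in> G"
  obtains k where "k \<in> G" "\<And>x. x \<in> carrier W \<Longrightarrow> k x = g (h x)"
proof -
  have "g \<otimes>\<^bsub>AutoGroup W\<^esub> h \<in> G"
    using automorphisms assms subgroup.m_closed
    unfolding generator_automorphism_group_def by metis
  then have "compose (carrier W) g h \<in> G"
    using assms aut_Bij by (simp add: AutoGroup_def BijGroup_def)
  then show ?thesis using that[of "compose (carrier W) g h"] by (simp add: compose_def)
qed

lemma aut_inverse:
  assumes "g \<in> G"
  obtains h where "h \<in> G" "\<And>x. x \<in> carrier W \<Longrightarrow> h (g x) = x"
proof -
  interpret A: group "AutoGroup W" by (rule AutoGroup)
  let ?h = "inv\<^bsub>AutoGroup W\<^esub> g"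
  have sub: "subgroup G (AutoGroup W)"
    using automorphisms unfolding generator_automorphism_group_def by blast
  then have h: "?h \<in> G" using assms subgroup.m_inv_closed by metis
  have "?h \<otimes>\<^bsub>AutoGroup W\<^esub> g = \<one>\<^bsub>AutoGroup W\<^esub>"
    using A.l_inv[of g] sub assms subgroup.mem_carrier by metis
  then have "compose (carrier W) ?h g = (\<lambda>x\<in>carrier W. x)"
    using h assms aut_Bij by (simp add: AutoGroup_def BijGroup_def)
  then have "?h (g x) = x" if "x \<in> carrier W" for x
    using that by (metis compose_eq restrict_apply')
  with h that show ?thesis by blast
qed

lemma aut_ev: "\<lbrakk>g \<in> G; xs \<in> lists S\<rbrakk> \<Longrightarrow> g (ev xs) = ev (map g xs)"
proof (induction xs)
  case Nil
  then show ?case using group_hom.hom_one[OF aut_group_hom] by simp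
next
  case (Cons s xs)
  then show ?case by (simp add: aut_mult)
qed

lemma aut_len_le:
  assumes "g \<in> G" "x \<in> carrier W" shows "len (g x) \<le> len x"
proof -
  obtain xs where xs: "xs \<in> lists S" "ev xs = x" "length xs = len x"
    using reduced_word assms by blast
  then have "map g xs \<in> lists S" using assms aut_gen by (auto simp: in_lists_conv_set)
  from len_le[OF this] show ?thesis using xs aut_ev[OF assms(1) xs(1)] by simp
qed

lemma aut_generate:
  assumes "J \<subseteq> S" "g \<in> G" "\<And>s. s \<in> J \<Longrightarrow> g s \<in> J" "x \<in> generate W J"
  shows "g x \<in> generate W J"
proof -
  obtain xs where xs: "xs \<in> lists J" "x = ev xs" using assms generate_words by auto
  then have "g x = ev (map g xs)" using assms by (auto intro: aut_ev)
  moreover have "map g xs \<in> lists J" using xs assms by auto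
  ultimately show ?thesis using generate_words assms(1) by auto
qed

lemma fixed_closed: "u \<in> fixed_points W G \<Longrightarrow> u \<in> carrier W"
  and fixed_aut: "\<lbrakk>u \<in> fixed_points W G; g \<in> G\<rbrakk> \<Longrightarrow> g u = u"
  by (auto simp: fixed_points_def)

lemma orbit_finite_generate: "J \<in> finite_type_orbits W S G \<Longrightarrow> finite (generate W J)"
  and orbit_obtain: "J \<in> finite_type_orbits W S G \<Longrightarrow> \<exists>s\<in>S. J = {g s | g. g \<in> G}"
  by (auto simp: finite_type_orbits_def orbits_def orbit_def)

lemma orbit_subset: "J \<in> finite_type_orbits W S G \<Longrightarrow> J \<subseteq> S"
  using orbit_obtain aut_gen by blast

lemma orbit_nonempty: "J \<in> finite_type_orbits W S G \<Longrightarrow> J \<noteq> {}"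
  using orbit_obtain[of J] subgroup.one_closed automorphisms
  unfolding generator_automorphism_group_def by fastforce

lemma orbit_invariant:
  assumes "J \<in> finite_type_orbits W S G" "g \<in> G" "s \<in> J"
  shows "g s \<in> J"
proof -
  obtain r where r: "r \<in> S" "J = {g r | g. g \<in> G}" using orbit_obtain assms by blast
  then obtain h where h: "h \<in> G" "s = h r" using assms by blast
  obtain k where k: "k \<in> G" "\<And>x. x \<in> carrier W \<Longrightarrow> k x = g (h x)"
    using aut_compose[OF assms(2) h(1)] by metis
  then have "g s = k r" using h gen_closed[OF r(1)] by simp
  with k r show ?thesis by blast
qed

lemma orbit_transitive:
  assumes "J \<in> finite_type_orbits W S G" "s \<in> J" "t \<in> J"
  obtains g where "g \<in> G" "g s = t"
proof -
  obtain r where r: "r \<in> S" "J = {g r | g. g \<in> G}" using orbit_obtain assms by blast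
  then obtain h k where h: "h \<in> G" "s = h r" and k: "k \<in> G" "t = k r" using assms by blast
  obtain h' where h': "h' \<in> G" "\<And>x. x \<in> carrier W \<Longrightarrow> h' (h x) = x"
    using aut_inverse[OF h(1)] by metis
  obtain g where "g \<in> G" "\<And>x. x \<in> carrier W \<Longrightarrow> g x = k (h' x)"
    using aut_compose[OF k(1) h'(1)] by metis
  then have "g s = t" using h h' k r aut_closed by simp
  with \<open>g \<in> G\<close> that show ?thesis by blast
qed

text \<open>An automorphism taking \<open>s\<close> to \<open>t\<close> fixes \<open>u\<close>,
  hence takes \<open>s \<otimes> u\<close> to \<open>t \<otimes> u\<close>, and it does not raise
  the length.\<close>

lemma orbit_descents:
  assumes J: "J \<in> finite_type_orbits W S G" and u: "u \<in> fixed_points W G"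
    and "s \<in> J" "t \<in> J" "s \<in> inversions u"
  shows "t \<in> inversions u"
proof -
  obtain g where g: "g \<in> G" "g s = t" using orbit_transitive[OF J assms(3,4)] .
  have c: "u \<in> carrier W" "s \<in> S" "t \<in> S" using u fixed_closed orbit_subset[OF J] assms by auto
  have "t \<otimes> u = g (s \<otimes> u)" using g c u by (simp add: aut_mult fixed_aut)
  then have "len (t \<otimes> u) \<le> len (s \<otimes> u)" using g c aut_len_le by simp
  then show ?thesis using gen_inversion_iff c assms(5) by fastforce
qed

section \<open>Longest elements attached to orbits\<close>

abbreviation w0 :: "'a set \<Rightarrow> 'a" where "w0 \<equiv> longest_element W S"

lemma
  assumes "J \<in> finite_type_orbits W S G"
  shows w0_generate: "w0 J \<in> generate W J"
    and w0_maximal: "x \<in> generate W J \<Longrightarrow> len x \<le> len (w0 J)"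
proof -
  \<comment> \<open>\<open>ARG_MAX\<close> over natural numbers is attained once the values are
    bounded; finiteness of the parabolic subgroup supplies the bound.\<close>
  have bound: "\<forall>y. y \<in> generate W J \<longrightarrow> len y < Suc (Max (len ` generate W J))"
    using orbit_finite_generate[OF assms] by (simp add: less_Suc_eq_le)
  show "w0 J \<in> generate W J"
    unfolding longest_element_def using arg_max_natI[OF generate.one bound] .
  show "len x \<le> len (w0 J)" if "x \<in> generate W J"
    unfolding longest_element_def using arg_max_nat_le[OF that bound] .
qed

lemma w0_closed: "J \<in> finite_type_orbits W S G \<Longrightarrow> w0 J \<in> carrier W"
  using w0_generate generate_closed orbit_subset by blast

lemma w0_descents:
  assumes "J \<in> finite_type_orbits W S G" "s \<in> J"
  shows "s \<in> inversions (w0 J)"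
proof (rule ccontr)
  assume "s \<notin> inversions (w0 J)"
  moreover have "s \<in> S" using assms orbit_subset by blast
  moreover have "len (s \<otimes> w0 J) \<le> len (w0 J)"
    using assms w0_generate by (intro w0_maximal) (auto intro: generate.eng generate.incl)
  ultimately show False using assms w0_closed by (simp add: len_gen_mult(2))
qed

lemma w0_not_one: "J \<in> finite_type_orbits W S G \<Longrightarrow> w0 J \<noteq> \<one>"
  using w0_descents orbit_nonempty by fastforce

text \<open>A nontrivial element has some descent in \<open>J\<close>, invariance spreads it over
  the orbit, and only the longest element has all of \<open>J\<close> as descents.\<close>

lemma fixed_generate:
  assumes J: "J \<in> finite_type_orbits W S G" and "a \<in> generate W J" "a \<in> fixed_points W G"
    and "a \<noteq> \<one>"
  shows "a = w0 J"
proof -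
  obtain s where "s \<in> J" "s \<in> inversions a"
    using generate_descent[OF orbit_subset[OF J] assms(2,4)] by metis
  then have "t \<in> inversions a" if "t \<in> J" for t using orbit_descents[OF J assms(3)] that by blast
  then show ?thesis
    using all_descents_maximal[OF orbit_subset[OF J] w0_generate[OF J] w0_maximal[OF J] assms(2)]
    by blast
qed

end

section \<open>The Coxeter system of the fixed subgroup\<close>

locale fixed_coxeter = coxeter_automorphisms W S m G + T: coxeter Wt St mt
  for W :: "('a, 'c) monoid_scheme" (structure) and S m G
    and Wt :: "('b, 'd) monoid_scheme" and St mt +
  fixes st :: "'a set \<Rightarrow> 'b" and \<phi> :: "'b \<Rightarrow> 'a"
  assumes fixed_system: "fixed_coxeter_system W S G Wt St st \<phi>"
begin

lemma phi_hom: "\<phi> \<in> hom Wt W"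
  and phi_inj: "inj_on \<phi> (carrier Wt)"
  and phi_image: "\<phi> ` carrier Wt = fixed_points W G"
  and phi_st: "J \<in> finite_type_orbits W S G \<Longrightarrow> \<phi> (st J) = w0 J"
  and St_eq: "St = st ` finite_type_orbits W S G"
  using fixed_system unfolding fixed_coxeter_system_def by blast+

lemma phi_fixed [simp]: "x \<in> carrier Wt \<Longrightarrow> \<phi> x \<in> fixed_points W G"
  using phi_image by blast

lemma phi_closed [simp]: "x \<in> carrier Wt \<Longrightarrow> \<phi> x \<in> carrier W"
  using phi_fixed fixed_closed by blast

lemma phi_mult [simp]:
  "\<lbrakk>x \<in> carrier Wt; y \<in> carrier Wt\<rbrakk> \<Longrightarrow> \<phi> (x \<otimes>\<^bsub>Wt\<^esub> y) = \<phi> x \<otimes> \<phi> y"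
  using phi_hom hom_mult by metis

lemma phi_one [simp]: "\<phi> \<one>\<^bsub>Wt\<^esub> = \<one>"
  using hom_one[OF phi_hom T.is_group is_group] .

lemma phi_inv: "x \<in> carrier Wt \<Longrightarrow> \<phi> (inv\<^bsub>Wt\<^esub> x) = inv (\<phi> x)"
  by (metis T.inv_closed T.l_inv inv_equality phi_closed phi_mult phi_one)

lemma st_in [simp]: "J \<in> finite_type_orbits W S G \<Longrightarrow> st J \<in> St"
  using St_eq by blast

section \<open>Transfer of descents along \<phi>\<close>

lemma w0_square:
  assumes "J \<in> finite_type_orbits W S G" shows "w0 J \<otimes> w0 J = \<one>"
  using phi_mult[of "st J" "st J"] assms by (simp add: phi_st)

text \<open>Iterating the cocycle rule over a product of longest elements, every inversion comes
  from some factor \<open>w0 J\<close>, conjugated by the image of the preceding prefix. Inversions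
  of \<open>w0 J\<close> lie in \<open>generate W J\<close>.\<close>

lemma phi_inversion_letter:
  assumes "zs \<in> lists St" "t \<in> inversions (\<phi> (T.ev zs))"
  shows "\<exists>as J bs. J \<in> finite_type_orbits W S G \<and> zs = as @ st J # bs \<and>
    inv (\<phi> (T.ev as)) \<otimes> t \<otimes> \<phi> (T.ev as) \<in> generate W J"
  using assms
proof (induction zs arbitrary: t)
  case (Cons z zs)
  then have z: "z \<in> St" "zs \<in> lists St" by auto
  then obtain J where J: "J \<in> finite_type_orbits W S G" "z = st J" using St_eq by blast
  have tc: "t \<in> carrier W" using Cons.prems inversions_closed by blast
  note w = w0_closed[OF J(1)]
  have "t \<in> inversions (w0 J \<otimes> \<phi> (T.ev zs))" using Cons.prems J z by (simp add: phi_st)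
  then consider "t \<in> inversions (w0 J)" | "inv (w0 J) \<otimes> t \<otimes> w0 J \<in> inversions (\<phi> (T.ev zs))"
    using inversions_mult[of "w0 J" "\<phi> (T.ev zs)" t] w z tc by auto
  then show ?case
  proof cases
    case 1
    then have "t \<in> generate W J"
      using inversions_generate[OF orbit_subset[OF J(1)] w0_generate[OF J(1)]] by blast
    then show ?thesis using J tc by (intro exI[of _ "[]"] exI[of _ J] exI[of _ zs]) simp
  next
    case 2
    from Cons.IH[OF this] obtain as K bs where
      *: "K \<in> finite_type_orbits W S G" "zs = as @ st K # bs"
      "inv (\<phi> (T.ev as)) \<otimes> (inv (w0 J) \<otimes> t \<otimes> w0 J) \<otimes> \<phi> (T.ev as) \<in> generate W K" by blast
    then have as: "as \<in> lists St" using z by auto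
    have "inv (\<phi> (T.ev (z # as))) \<otimes> t \<otimes> \<phi> (T.ev (z # as)) =
        inv (\<phi> (T.ev as)) \<otimes> (inv (w0 J) \<otimes> t \<otimes> w0 J) \<otimes> \<phi> (T.ev as)"
      using as J tc w by (simp add: phi_st inv_mult_group m_assoc)
    with * show ?thesis by (intro exI[of _ "z # as"] exI[of _ K] exI[of _ bs]) simp
  qed
qed simp

text \<open>If \<open>a\<inverse> s a \<in> W\<^sub>K\<close> for one \<open>s \<in> J\<close> and a fixed point \<open>a\<close>, then \<open>a\<inverse> W\<^sub>J a \<subseteq> W\<^sub>K\<close> by
  invariance, and \<open>a\<inverse> w\<^sub>0(J) a\<close> must be the only nontrivial fixed point \<open>w\<^sub>0(K)\<close> of \<open>W\<^sub>K\<close>.\<close>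

lemma phi_conj_w0:
  assumes J: "J \<in> finite_type_orbits W S G" and K: "K \<in> finite_type_orbits W S G"
    and a: "a \<in> carrier Wt" and s: "s \<in> J" "inv (\<phi> a) \<otimes> s \<otimes> \<phi> a \<in> generate W K"
  shows "st J \<otimes>\<^bsub>Wt\<^esub> a = a \<otimes>\<^bsub>Wt\<^esub> st K"
proof -
  have ac: "\<phi> a \<in> carrier W" using a by simp
  have JK: "J \<subseteq> S" "K \<subseteq> S" using orbit_subset J K by auto
  have conj: "inv (\<phi> a) \<otimes> x \<otimes> \<phi> a \<in> generate W K" if "x \<in> generate W J" for x
    using JK(1) that
  proof (induction rule: generate_len_induct)
    case one
    then show ?case using ac by (simp add: generate.one)
  next
    case (gen t y)
    \<comment> \<open>Transitivity moves the given letter \<open>s\<close> to \<open>t\<close>. As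
      \<open>g\<close> fixes \<open>\<phi> a\<close> and preserves \<open>generate W K\<close>, the
      hypothesis on \<open>s\<close> passes to \<open>t\<close>.\<close>
    obtain g where g: "g \<in> G" "g s = t" using orbit_transitive[OF J s(1) gen(1)] .
    have c: "s \<in> S" "t \<in> S" "y \<in> carrier W" using s gen JK generate_closed by auto
    have "g (inv (\<phi> a)) = inv (\<phi> a)"
      using group_hom.hom_inv[OF aut_group_hom[OF g(1)] ac] fixed_aut[OF _ g(1)] a by simp
    then have "g (inv (\<phi> a) \<otimes> s \<otimes> \<phi> a) = inv (\<phi> a) \<otimes> t \<otimes> \<phi> a"
      using g c a fixed_aut[OF phi_fixed g(1)] by (simp add: aut_mult)
    then have "inv (\<phi> a) \<otimes> t \<otimes> \<phi> a \<in> generate W K"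
      using aut_generate[OF JK(2) g(1) _ s(2)] orbit_invariant[OF K g(1)] by simp
    from generate.eng[OF this gen(4)] show ?case using c ac by (simp add: m_assoc)
  qed
  \<comment> \<open>Conjugating in \<open>Wt\<close> makes the image a fixed point at once, and
    injectivity of \<phi> later identifies \<open>?x\<close> with \<open>st K\<close>.\<close>
  let ?x = "inv\<^bsub>Wt\<^esub> a \<otimes>\<^bsub>Wt\<^esub> st J \<otimes>\<^bsub>Wt\<^esub> a"
  have xc: "?x \<in> carrier Wt" using a J by simp
  have x: "\<phi> ?x = inv (\<phi> a) \<otimes> w0 J \<otimes> \<phi> a" using a J by (simp add: phi_inv phi_st)
  have "\<phi> ?x \<noteq> \<one>"
  proof
    assume "\<phi> ?x = \<one>"
    then have "\<phi> a \<otimes> (inv (\<phi> a) \<otimes> w0 J \<otimes> \<phi> a) = \<phi> a" using x ac by simp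
    then have "w0 J \<otimes> \<phi> a = \<one> \<otimes> \<phi> a" using ac w0_closed[OF J] by (simp add: m_assoc)
    then show False using ac w0_closed[OF J] w0_not_one[OF J] by (metis one_closed right_cancel)
  qed
  moreover have "\<phi> ?x \<in> generate W K" using conj[OF w0_generate[OF J]] x by simp
  ultimately have "\<phi> ?x = \<phi> (st K)"
    using fixed_generate[OF K] phi_fixed[OF xc] by (simp add: phi_st K)
  then have "?x = st K" using phi_inj xc K by (auto dest: inj_onD)
  then show ?thesis using a J by (metis T.gen_closed T.inv_cancel(2) T.m_assoc T.inv_closed T.m_closed st_in)
qed

text \<open>The inversion \<open>s\<close> singles out a letter \<open>st K\<close> in a reduced
  word of \<open>v\<close>. By \<open>phi_conj_w0\<close>, \<open>st J\<close> moves through the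
  prefix before it and cancels \<open>st K\<close>, so \<open>st J\<close> shortens
  \<open>v\<close>.\<close>

lemma phi_descent:
  assumes J: "J \<in> finite_type_orbits W S G" and s: "s \<in> J" and v: "v \<in> carrier Wt"
    and "s \<in> inversions (\<phi> v)"
  shows "st J \<in> T.inversions v"
proof -
  obtain zs where zs: "zs \<in> lists St" "T.ev zs = v" "length zs = T.len v"
    using T.reduced_word[OF v] .
  obtain as K bs where *: "K \<in> finite_type_orbits W S G" "zs = as @ st K # bs"
    "inv (\<phi> (T.ev as)) \<otimes> s \<otimes> \<phi> (T.ev as) \<in> generate W K"
    using phi_inversion_letter[OF zs(1)] assms(4) zs(2) by blast
  have ab: "as \<in> lists St" "bs \<in> lists St" using zs * by auto
  have "st J \<otimes>\<^bsub>Wt\<^esub> v = (st J \<otimes>\<^bsub>Wt\<^esub> T.ev as) \<otimes>\<^bsub>Wt\<^esub> (st K \<otimes>\<^bsub>Wt\<^esub> T.ev bs)"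
    using zs * ab J T.ev_append[of as "st K # bs"] by (simp add: T.m_assoc)
  also have "\<dots> = T.ev (as @ bs)"
    using phi_conj_w0[OF J *(1) _ s *(3)] ab * by (simp add: T.m_assoc T.ev_append)
  finally have "T.len (st J \<otimes>\<^bsub>Wt\<^esub> v) \<le> length (as @ bs)" using T.len_le[of "as @ bs"] ab by simp
  then show ?thesis using zs * J v by (simp add: T.gen_inversion_iff)
qed

text \<open>For the remaining direction, suppose \<open>s\<close> is not an inversion of
  \<open>\<phi> v\<close>. Then neither \<open>\<phi> v\<close> nor
  \<open>w0 J \<otimes> \<phi> v\<close> has a descent in \<open>J\<close>, the latter by
  \<open>phi_descent\<close>. Multiplication by \<open>w0 J\<close> would add its length in both
  directions, forcing that length to be zero.\<close>

lemma phi_inversions: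
  assumes J: "J \<in> finite_type_orbits W S G" and s: "s \<in> J" and v: "v \<in> carrier Wt"
  shows "st J \<in> T.inversions v \<longleftrightarrow> s \<in> inversions (\<phi> v)"
proof
  assume st: "st J \<in> T.inversions v"
  show "s \<in> inversions (\<phi> v)"
  proof (rule ccontr)
    assume no: "s \<notin> inversions (\<phi> v)"
    let ?w = "\<phi> (st J \<otimes>\<^bsub>Wt\<^esub> v)"
    have w: "?w = w0 J \<otimes> \<phi> v" "w0 J \<otimes> ?w = \<phi> v"
      using J v w0_closed[OF J] by (simp_all add: phi_st w0_square flip: m_assoc)
    have "t \<notin> inversions (\<phi> v)" if "t \<in> J" for t
      using orbit_descents[OF J phi_fixed[OF v] that s] no by blast
    from len_mult_no_descents[OF orbit_subset[OF J] _ this w0_generate[OF J]] v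
    have 1: "len ?w = len (w0 J) + len (\<phi> v)" using w by simp
    have "st J \<notin> T.inversions (st J \<otimes>\<^bsub>Wt\<^esub> v)"
      using st J v by (simp add: T.inversions_gen_mult)
    then have "t \<notin> inversions ?w" if "t \<in> J" for t using phi_descent[OF J that] J v by auto
    from len_mult_no_descents[OF orbit_subset[OF J] _ this w0_generate[OF J]] J v
    have "len (\<phi> v) = len (w0 J) + len ?w" using w(2) by simp
    with 1 have "len (w0 J) = 0" by simp
    moreover have "s \<in> S" using s orbit_subset[OF J] by blast
    ultimately show False
      using w0_descents[OF J s] len_gen_mult(1)[of s "w0 J"] w0_closed[OF J] by simp
  qed
qed (rule phi_descent[OF assms])

lemma phi_no_descents:
  assumes "J \<in> finite_type_orbits W S G" "v \<in> carrier Wt" "st J \<notin> T.inversions v" "s \<in> J"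
  shows "s \<notin> inversions (\<phi> v)"
  using phi_inversions assms by blast

lemma len_phi_mult:
  assumes J: "J \<in> finite_type_orbits W S G" and v: "v \<in> carrier Wt" and "st J \<notin> T.inversions v"
  shows "len (w0 J \<otimes> \<phi> v) = len (w0 J) + len (\<phi> v)"
  using len_mult_no_descents[OF orbit_subset[OF J] _ phi_no_descents[OF assms] w0_generate[OF J]] v
  by simp

section \<open>Comparison of the two Bruhat orders\<close>

text \<open>One reduced word is fixed for each letter, so that concatenation takes subwords to
  subwords.\<close>

definition letter_word :: "'b \<Rightarrow> 'a list" where
  "letter_word z = (SOME xs. reduced_expression W S xs (\<phi> z))"

lemma letter_word:
  assumes "z \<in> St"
  shows "letter_word z \<in> lists S" "ev (letter_word z) = \<phi> z" "length (letter_word z) = len (\<phi> z)"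
proof -
  have "\<exists>xs. reduced_expression W S xs (\<phi> z)"
    using reduced_word[of "\<phi> z"] assms by (auto simp: reduced_expression_iff)
  then have "reduced_expression W S (letter_word z) (\<phi> z)"
    unfolding letter_word_def by (rule someI_ex)
  then show "letter_word z \<in> lists S" "ev (letter_word z) = \<phi> z" "length (letter_word z) = len (\<phi> z)"
    by (auto simp: reduced_expression_iff)
qed

text \<open>The first letter \<open>st J\<close> of a reduced word is not a descent of the rest, so
  \<open>len_phi_mult\<close> makes the lengths of the images add up.\<close>

lemma reduced_expression_phi:
  "reduced_expression Wt St zs v \<Longrightarrow> reduced_expression W S (concat (map letter_word zs)) (\<phi> v)"
  unfolding reduced_expression_iff T.reduced_expression_iff
proof (induction zs arbitrary: v)
  case (Cons z zs)
  then have z: "z \<in> St" "zs \<in> lists St" and v: "v = T.ev (z # zs)" by auto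
  then obtain J where J: "J \<in> finite_type_orbits W S G" "z = st J" using St_eq by blast
  have red: "length zs = T.len (T.ev zs)" "z \<notin> T.inversions (T.ev zs)"
    using T.reduced_Cons[OF z] Cons.prems by auto
  have IH: "concat (map letter_word zs) \<in> lists S" "ev (concat (map letter_word zs)) = \<phi> (T.ev zs)"
    "length (concat (map letter_word zs)) = len (\<phi> (T.ev zs))"
    using Cons.IH[of "T.ev zs"] z red by auto
  have "len (\<phi> v) = len (\<phi> z) + len (\<phi> (T.ev zs))"
    using len_phi_mult[OF J(1), of "T.ev zs"] red z v J by (simp add: phi_st)
  then show ?case
    using IH letter_word[OF z(1)] z v by (simp add: ev_append)
qed simp

lemma subseq_concat_map: "subseq ys xs \<Longrightarrow> subseq (concat (map f ys)) (concat (map f xs))"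
  by (induction rule: list_emb.induct) (auto intro: list_emb_append_mono list_emb_append2)

lemma bruhat_le_phi:
  assumes "bruhat_le Wt St v w" shows "bruhat_le W S (\<phi> v) (\<phi> w)"
  using assms reduced_expression_phi subseq_concat_map unfolding bruhat_le_def by metis

text \<open>Induct on a product \<open>z \<otimes> w\<close> in \<open>Wt\<close> with
  \<open>z = st J\<close> lengthening \<open>w\<close>. Its image has minimal representative
  \<open>\<phi> w\<close>, so \<open>bruhat_chain_minimal\<close> descends to \<open>w\<close>, and
  \<open>bruhat_le_gen_mult\<close> restores \<open>z\<close>.\<close>

lemma bruhat_chain_phi:
  assumes "w \<in> carrier Wt" "v \<in> carrier Wt" "bruhat_chain (\<phi> v) (\<phi> w)"
  shows "bruhat_le Wt St v w"
proof -
  have "w \<in> generate Wt St" using assms T.generates by simp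
  with subset_refl show ?thesis using assms(2,3)
  proof (induction arbitrary: v rule: T.generate_len_induct)
    case one
    then have "\<phi> v = \<phi> \<one>\<^bsub>Wt\<^esub>" using bruhat_chain_one by simp
    then have "v = \<one>\<^bsub>Wt\<^esub>" by (rule inj_onD[OF phi_inj _ one(1) T.one_closed])
    then show ?case using T.bruhat_le_refl_one by simp
  next
    case (gen z w)
    then obtain J where J: "J \<in> finite_type_orbits W S G" "z = st J" using St_eq by blast
    have wc: "w \<in> carrier Wt" using gen T.generates by simp
    note chain = bruhat_chain_minimal[OF orbit_subset[OF J(1)] _ w0_generate[OF J(1)],
      where y = "\<phi> w", OF _ _ _ _ phi_no_descents[OF J(1) wc]]
    have pw: "\<phi> (z \<otimes>\<^bsub>Wt\<^esub> w) = w0 J \<otimes> \<phi> w" using J wc by (simp add: phi_st)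
    show ?case
    proof (cases "z \<in> T.inversions v")
      case False
      \<comment> \<open>Here \<open>\<phi> v\<close> is its own minimal representative, with
        parabolic factor \<open>\<one>\<close>.\<close>
      have "bruhat_chain (\<phi> v) (\<phi> w)"
        using chain[of \<one> "\<phi> v"] phi_no_descents[OF J(1) gen.prems(1)] False gen pw J wc
        by (simp add: generate.one)
      then show ?thesis using gen T.bruhat_le_gen_mult(1) by blast
    next
      case True
      \<comment> \<open>Here the minimal representative of the coset of \<open>\<phi> v\<close> is
        \<open>\<phi> v'\<close>, with parabolic factor \<open>w0 J\<close>.\<close>
      define v' where "v' = z \<otimes>\<^bsub>Wt\<^esub> v"
      have v': "v' \<in> carrier Wt" "v = z \<otimes>\<^bsub>Wt\<^esub> v'" "z \<notin> T.inversions v'"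
        using True gen by (simp_all add: v'_def T.inversions_gen_mult)
      have "\<phi> v = w0 J \<otimes> \<phi> v'" using v' J by (simp add: phi_st)
      then have "bruhat_chain (\<phi> v') (\<phi> w)"
        using chain[of "w0 J" "\<phi> v'"] phi_no_descents[OF J(1) v'(1)] v' gen pw J wc
          w0_generate[OF J(1)]
        by simp
      then have "bruhat_le Wt St v' w" using gen v' by blast
      then show ?thesis using T.bruhat_le_gen_mult(2) gen v' by blast
    qed
  qed
qed

text \<open>Chains in \<open>W\<close> close the circle: the order of \<open>Wt\<close> gives the
  order of \<open>W\<close>, this gives a chain, and the chain gives back the order of
  \<open>Wt\<close>.\<close>

lemma bruhat_le_phi_iff:
  "\<lbrakk>v \<in> carrier Wt; w \<in> carrier Wt\<rbrakk> \<Longrightarrow> bruhat_le W S (\<phi> v) (\<phi> w) \<longleftrightarrow> bruhat_le Wt St v w"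
  using bruhat_le_phi bruhat_chain_phi bruhat_le_imp_chain by blast

end

theorem theoremA1:
  fixes W :: "('a, 'c) monoid_scheme" and S :: "'a set" and G :: "('a \<Rightarrow> 'a) set"
    and Wt :: "('b, 'd) monoid_scheme" and St :: "'b set"
    and st :: "'a set \<Rightarrow> 'b" and \<phi> :: "'b \<Rightarrow> 'a"
  assumes "coxeter_system W S"
    and "finite S"
    and "generator_automorphism_group W S G"
    and "fixed_coxeter_system W S G Wt St st \<phi>"
  shows "poset_isomorphic (fixed_points W G) (bruhat_le W S) (carrier Wt) (bruhat_le Wt St)"
proof -
  obtain m where "coxeter W S m" using assms(1) coxeter_system_imp_coxeter by blast
  moreover obtain mt where "coxeter Wt St mt"
    using assms(4) coxeter_system_imp_coxeter unfolding fixed_coxeter_system_def by blast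
  ultimately interpret fixed_coxeter W S m G Wt St mt st \<phi>
    using assms
    by (simp add: fixed_coxeter_def fixed_coxeter_axioms_def coxeter_automorphisms_def
      coxeter_automorphisms_axioms_def)
  let ?f = "inv_into (carrier Wt) \<phi>"
  have bij: "bij_betw ?f (fixed_points W G) (carrier Wt)"
    using phi_inj phi_image by (intro bij_betw_inv_into) (simp add: bij_betw_def)
  have "bruhat_le W S x y \<longleftrightarrow> bruhat_le Wt St (?f x) (?f y)"
    if "x \<in> fixed_points W G" "y \<in> fixed_points W G" for x y
  proof -
    have "\<phi> (?f x) = x" "\<phi> (?f y) = y" using that phi_image by (auto intro: f_inv_into_f)
    moreover have "?f x \<in> carrier Wt" "?f y \<in> carrier Wt" using that bij bij_betwE by blast+
    ultimately show ?thesis using bruhat_le_phi_iff by metis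
  qed
  then show ?thesis unfolding poset_isomorphic_def using bij by blast
qed

end
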